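(* For any $k$, there is a family $\mathcal{F}$ of $2dk+1$ convex sets in $\mathbb{R}^d$ such that the intersection of any $2d$ of them has diameter at least one and, for any partition of $\mathcal{F}$ into $k$ parts, there is a part whose intersection has diameter strictly smaller than one.
   Context: Here $d$ (the dimension) and $k$ are positive integers. The diameter of a set $X\subset\mathbb{R}^d$ is the supremum of Euclidean distances between two of its points; the empty set is regarded as having diameter smaller than one. The intersection of a part means the intersection of all the sets belonging to it.
   Formalization: The dimension d is assumed to be at least 2: for d = 1 the claim fails for every k, since finitely many intervals that pairwise intersect in diameter at least one all intersect in diameter at least one. *)

theory Defs
  imports "HOL-Analysis.Analysis" "HOL-Library.Disjoint_Sets"
begin

(* The library's real-valued diameter is unspecified on unbounded sets, whereas
   intersections of convex sets may be unbounded and then have infinite diameter.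
   On the empty set the supremum below is 0, hence smaller than one. *)
definition ediam :: "'a::metric_space set \<Rightarrow> ennreal" where
  "ediam X = (SUP (x, y) \<in> X \<times> X. ennreal (dist x y))"

(* The claim is restricted to dimension at least 2, because it fails on the real line:
   if any two of finitely many (at least two) intervals meet in a set of diameter at
   least one, then so do all of them, the intersection being delimited by the greatest
   left and the smallest right endpoint.

   A partition has nonempty parts, as in partition_on.  Allowing empty parts (whose
   intersection is the whole space) would give an equivalent claim: splitting a part
   only enlarges intersections. *)

end

theory Submission imports Defs begin

text \<open>
  A ball of diameter one has no other pairs of points at distance one than its pairs of antipodal
  boundary points. Attach to every \<open>m\<close>-subset \<open>S\<close> of the index set its own antipodal pair
  \<open>\<plusminus>u S\<close>, and let \<open>A i\<close> be the convex hull of the pairs attached to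
  the sets \<open>S\<close> containing \<open>i\<close>. The sets \<open>A i\<close> with \<open>i \<in> S\<close> all contain
  \<open>\<plusminus>u S\<close>. Boundary points of the ball are extreme, so a boundary point that lies
  in \<open>A i\<close> for more than \<open>m\<close> indices \<open>i\<close> would have to be \<open>\<plusminus>u S\<close> for
  an \<open>m\<close>-set \<open>S\<close> containing them all. By pigeonhole with \<open>m = 2d\<close>, every partition
  of \<open>2dk + 1\<close> such sets into \<open>k\<close> parts has a part with more than \<open>2d\<close> members.
\<close>

lemma ediam_ge: "x \<in> X \<Longrightarrow> y \<in> X \<Longrightarrow> ennreal (dist x y) \<le> ediam X"
  unfolding ediam_def by (rule SUP_upper2[of "(x, y)"]) auto

text \<open>On a nonempty compact set the distance attains its maximum over pairs, so a strict bound
  on every pair stays strict for the supremum.\<close>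

lemma ediam_compact_less:
  fixes X :: "'a::metric_space set"
  assumes "compact X" "r > 0" and less: "\<And>x y. x \<in> X \<Longrightarrow> y \<in> X \<Longrightarrow> dist x y < r"
  shows "ediam X < ennreal r"
proof (cases "X = {}")
  case True
  then show ?thesis using \<open>r > 0\<close> by (simp add: ediam_def bot_ennreal)
next
  case False
  then obtain z where z: "z \<in> X \<times> X"
    and max: "\<And>p. p \<in> X \<times> X \<Longrightarrow> dist (fst p) (snd p) \<le> dist (fst z) (snd z)"
    using continuous_attains_sup[OF compact_Times[OF \<open>compact X\<close> \<open>compact X\<close>], of "\<lambda>p. dist (fst p) (snd p)"]
      continuous_on_dist[OF continuous_on_fst[OF continuous_on_id] continuous_on_snd[OF continuous_on_id]]
    by blast
  have "ediam X \<le> ennreal (dist (fst z) (snd z))"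
    unfolding ediam_def by (intro SUP_least) (use max in \<open>force intro: ennreal_leI\<close>)
  also have "\<dots> < ennreal r"
    using less z \<open>r > 0\<close> by (auto intro!: ennreal_lessI)
  finally show ?thesis .
qed

text \<open>Inside a segment the distance to \<open>a\<close> drops strictly below the larger
  endpoint distance, so sphere points are extreme in the ball, hence in the smaller hull, whose
  extreme points are generators.\<close>

lemma sphere_Int_convex_hull_subset:
  fixes X :: "'a::euclidean_space set"
  assumes "X \<subseteq> cball a r"
  shows "sphere a r \<inter> convex hull X \<subseteq> X"
proof
  fix x assume x: "x \<in> sphere a r \<inter> convex hull X"
  have "convex hull X \<subseteq> cball a r"
    using assms by (simp add: hull_minimal)
  moreover have "x extreme_point_of cball a r"
    unfolding extreme_point_of_def
  proof (intro conjI ballI notI)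
    fix b c assume "b \<in> cball a r" "c \<in> cball a r" "x \<in> open_segment b c"
    then show False
      using x dist_decreases_open_segment[of x b c a] by auto
  qed (use x in auto)
  ultimately have "x extreme_point_of convex hull X"
    using x by (auto simp: extreme_point_of_def)
  then show "x \<in> X"
    by (rule extreme_point_of_convex_hull)
qed

text \<open>Project a line \<open>b + t a\<close> radially onto the sphere. The image lies in the
  open half-space of positive \<open>b\<close>-coordinate, which excludes antipodes, and the
  coordinate ratio recovers \<open>t\<close>.\<close>

lemma infinite_antipode_free_sphere_subset:
  assumes "DIM('a::euclidean_space) \<ge> 2" "r > 0"
  obtains W :: "'a::euclidean_space set"
  where "infinite W" "W \<subseteq> sphere 0 r" "\<And>v w. v \<in> W \<Longrightarrow> w \<in> W \<Longrightarrow> v \<noteq> - w"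
proof -
  obtain a b :: 'a where ab: "a \<in> Basis" "b \<in> Basis" "a \<noteq> b"
    using assms(1) by (metis One_nat_def card_le_Suc0_iff_eq finite_Basis not_less_eq_eq numeral_2_eq_2)
  define w where "w t = b + t *\<^sub>R a" for t :: real
  define v where "v t = r *\<^sub>R sgn (w t)" for t
  have w: "w t \<bullet> b = 1" "w t \<bullet> a = t" for t
    using ab by (auto simp: w_def inner_simps inner_Basis)
  then have w0: "w t \<noteq> 0" for t
    by (metis inner_zero_left zero_neq_one)
  then have pos: "v t \<bullet> b > 0" for t
    using w \<open>r > 0\<close> by (simp add: v_def sgn_div_norm)
  have ratio: "(v t \<bullet> a) / (v t \<bullet> b) = t" for t
    using w w0[of t] \<open>r > 0\<close> by (simp add: v_def sgn_div_norm)
  have "inj v"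
    by (metis injI ratio)
  then have "infinite (range v)"
    using finite_imageD infinite_UNIV_char_0 by blast
  moreover have "range v \<subseteq> sphere 0 r"
    using w0 \<open>r > 0\<close> by (auto simp: v_def norm_sgn)
  moreover have "x \<noteq> - y" if xy: "x \<in> range v" "y \<in> range v" for x y
  proof
    assume "x = - y"
    then have "x \<bullet> b + y \<bullet> b = 0" by simp
    moreover have "x \<bullet> b > 0" "y \<bullet> b > 0" using xy pos by auto
    ultimately show False by simp
  qed
  ultimately show thesis by (rule that)
qed

lemma convex_family_diameter_threshold:
  fixes m n :: nat
  assumes dim: "DIM('a::euclidean_space) \<ge> 2" and m: "1 \<le> m" "m < n"
  obtains A :: "nat \<Rightarrow> 'a::euclidean_space set"
  where "inj_on A {..<n}" "\<And>i. convex (A i)"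
    "\<And>S. S \<subseteq> {..<n} \<Longrightarrow> card S = m \<Longrightarrow> 1 \<le> ediam (\<Inter>i\<in>S. A i)"
    "\<And>S. S \<subseteq> {..<n} \<Longrightarrow> m < card S \<Longrightarrow> ediam (\<Inter>i\<in>S. A i) < 1"
proof -
  define M where "M = {S. S \<subseteq> {..<n} \<and> card S = m}"
  have finM: "finite M"
    by (simp add: M_def)
  obtain W :: "'a set" where W: "infinite W" "W \<subseteq> sphere 0 (1/2)"
    "\<And>v w. v \<in> W \<Longrightarrow> w \<in> W \<Longrightarrow> v \<noteq> - w"
    using infinite_antipode_free_sphere_subset[OF dim, of "1/2"] by auto
  obtain W' where W': "W' \<subseteq> W" "finite W'" "card W' = card M"
    using infinite_arbitrarily_large[OF W(1)] by metis
  obtain u where u: "bij_betw u M W'"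
    using finM W' by (metis finite_same_card_bij)
  have uW: "u S \<in> W" if "S \<in> M" for S
    using u W' that by (auto simp: bij_betw_def)
  have normu: "norm (u S) = 1/2" if "S \<in> M" for S
    using uW[OF that] W(2) by auto
  \<comment> \<open>Injectivity of \<open>u\<close> settles the first case; the second cannot occur,
    as \<open>W\<close> has no antipodes. Thus each pair determines its index set.\<close>
  have inju: "S = T" if "S \<in> M" "T \<in> M" "u S = u T \<or> u S = - u T" for S T
    using u that W(3)[OF uW uW, OF that(1,2)] by (auto simp: bij_betw_def inj_on_def)
  define V where "V i = (\<Union>S\<in>{S\<in>M. i \<in> S}. {u S, - u S})" for i
  define A where "A i = convex hull (V i)" for i
  have Vball: "V i \<subseteq> cball 0 (1/2)" for i
    using normu by (auto simp: V_def)
  have Aball: "A i \<subseteq> cball 0 (1/2)" for i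
    unfolding A_def using Vball by (simp add: hull_minimal)
  have compact: "compact (A i)" for i
    unfolding A_def V_def using finM by (auto intro!: finite_imp_compact_convex_hull)
  have mem: "u S \<in> A i \<and> - u S \<in> A i" if "S \<in> M" "i \<in> S" for i S
    unfolding A_def using that by (auto simp: V_def intro!: hull_inc)
  have boundary: "\<exists>S\<in>M. i \<in> S \<and> (x = u S \<or> x = - u S)" if "x \<in> A i" "norm x = 1/2" for x i
  proof -
    have "x \<in> V i"
      by (rule subsetD[OF sphere_Int_convex_hull_subset[OF Vball]]) (use that in \<open>simp add: A_def\<close>)
    then show ?thesis by (auto simp: V_def)
  qed
  have mem_iff: "u S \<in> A i \<longleftrightarrow> i \<in> S" if S: "S \<in> M" for S i
  proof
    assume "u S \<in> A i"
    then obtain T where T: "T \<in> M" "i \<in> T" "u S = u T \<or> u S = - u T"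
      using boundary normu[OF S] by blast
    then show "i \<in> S"
      using inju[OF S T(1,3)] by simp
  qed (use mem[OF S] in simp)
  show thesis
  proof (rule that)
    show "inj_on A {..<n}"
    proof (rule inj_onI, rule ccontr)
      fix i j assume ij: "i \<in> {..<n}" "j \<in> {..<n}" "A i = A j" "i \<noteq> j"
      \<comment> \<open>An \<open>m\<close>-set containing \<open>i\<close> but not \<open>j\<close>
        will separate \<open>A i\<close> from \<open>A j\<close>; its other \<open>m - 1\<close>
        elements fit because \<open>m < n\<close>.\<close>
      have "card ({..<n} - {i, j}) = n - 2"
        using ij by (subst card_Diff_subset) auto
      then have "m - 1 \<le> card ({..<n} - {i, j})"
        using m by linarith
      then obtain R where R: "R \<subseteq> {..<n} - {i, j}" "card R = m - 1" "finite R"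
        by (rule obtain_subset_with_card_n)
      have "insert i R \<in> M"
        using R m ij by (auto simp: M_def card_insert_if)
      then show False
        using mem_iff[of "insert i R" i] mem_iff[of "insert i R" j] ij R(1) by auto
    qed
    show "convex (A i)" for i
      by (simp add: A_def)
    show "1 \<le> ediam (\<Inter>i\<in>S. A i)" if "S \<subseteq> {..<n}" "card S = m" for S
    proof -
      have S: "S \<in> M" using that by (simp add: M_def)
      have "u S - - u S = 2 *\<^sub>R u S" by (simp add: scaleR_2)
      then have "dist (u S) (- u S) = 1"
        using normu[OF S] by (simp only: dist_norm norm_scaleR)
      then show ?thesis
        using ediam_ge[of "u S" "\<Inter>i\<in>S. A i" "- u S"] mem[OF S] by auto
    qed
    show "ediam (\<Inter>i\<in>S. A i) < 1" if S: "S \<subseteq> {..<n}" "m < card S" for S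
    proof -
      \<comment> \<open>Nonemptiness of \<open>S\<close> confines the intersection to the ball; over
        no indices it would be the whole space.\<close>
      obtain i where i: "i \<in> S"
        using S by fastforce
      have less: "norm x < 1/2" if x: "x \<in> (\<Inter>i\<in>S. A i)" for x
      proof (rule ccontr)
        assume "\<not> norm x < 1/2"
        then have nx: "norm x = 1/2"
          using x i Aball[of i] by fastforce
        then obtain T where T: "T \<in> M" "x = u T \<or> x = - u T"
          using boundary[of x i] x i by auto
        \<comment> \<open>Each \<open>A j\<close> puts \<open>x\<close> in the pair of some
          \<open>m\<close>-set containing \<open>j\<close>. All these sets equal \<open>T\<close>,
          so \<open>S\<close> would lie in the smaller set \<open>T\<close>.\<close>
        have "j \<in> T" if "j \<in> S" for j
        proof -
          obtain T' where T': "T' \<in> M" "j \<in> T'" "x = u T' \<or> x = - u T'"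
            using boundary[of x j] x nx \<open>j \<in> S\<close> by auto
          have "u T = u T' \<or> u T = - u T'"
            using T(2) T'(3) by (metis minus_minus)
          then show ?thesis
            using inju[OF T(1) T'(1)] T'(2) by simp
        qed
        then have "card S \<le> card T"
          using T(1) by (intro card_mono) (auto simp: M_def intro: finite_subset)
        then show False using S T(1) by (simp add: M_def)
      qed
      have "compact (\<Inter>i\<in>S. A i)"
        using i compact by (intro compact_Inter) auto
      moreover have "dist x y < 1" if "x \<in> (\<Inter>i\<in>S. A i)" "y \<in> (\<Inter>i\<in>S. A i)" for x y
        using less[OF that(1)] less[OF that(2)] norm_triangle_ineq4[of x y]
        by (simp add: dist_norm)
      ultimately show ?thesis
        using ediam_compact_less[of "\<Inter>i\<in>S. A i" 1] by simp
    qed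
  qed
qed

lemma partition_on_pigeonhole:
  assumes "finite F" "partition_on F P" "card P * m < card F"
  obtains Q where "Q \<in> P" "m < card Q"
proof -
  have "card F = (\<Sum>Q\<in>P. card Q)"
    using assms(1,2)
    by (metis finite_subset partition_onD1 product_partition Union_upper)
  also have "\<dots> \<le> card P * m" if "\<And>Q. Q \<in> P \<Longrightarrow> card Q \<le> m"
    using sum_bounded_above[of P card m] that by simp
  finally show thesis
    using that assms(3) by (meson not_le)
qed

theorem claim5p2:
  fixes k :: nat
  assumes "CARD('d::finite) \<ge> 2" and "k \<ge> 1"
  shows "\<exists>F :: (real ^ 'd) set set.
    card F = 2 * CARD('d) * k + 1 \<and>
    (\<forall>C\<in>F. convex C) \<and>
    (\<forall>G. G \<subseteq> F \<and> card G = 2 * CARD('d) \<longrightarrow> ediam (\<Inter>G) \<ge> 1) \<and>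
    (\<forall>P. partition_on F P \<and> card P = k \<longrightarrow> (\<exists>Q\<in>P. ediam (\<Inter>Q) < 1))"
proof -
  define m n where "m = 2 * CARD('d)" and "n = 2 * CARD('d) * k + 1"
  have *: "DIM(real ^ 'd) \<ge> 2" "1 \<le> m" "m < n"
    using assms by (auto simp: m_def n_def less_Suc_eq_le)
  obtain A :: "nat \<Rightarrow> (real ^ 'd) set" where A: "inj_on A {..<n}" "\<And>i. convex (A i)"
    "\<And>S. S \<subseteq> {..<n} \<Longrightarrow> card S = m \<Longrightarrow> 1 \<le> ediam (\<Inter>i\<in>S. A i)"
    "\<And>S. S \<subseteq> {..<n} \<Longrightarrow> m < card S \<Longrightarrow> ediam (\<Inter>i\<in>S. A i) < 1"
    using convex_family_diameter_threshold[OF *] by blast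
  define F where "F = A ` {..<n}"
  have cardF: "card F = n"
    using A(1) by (simp add: F_def card_image)
  \<comment> \<open>Injectivity of \<open>A\<close> turns subfamilies into index sets of the same
    size.\<close>
  have index: "\<exists>S\<subseteq>{..<n}. card S = card G \<and> G = A ` S" if "G \<subseteq> F" for G
    using that A(1) unfolding F_def
    by (metis card_image inj_on_subset subset_imageE)
  have "1 \<le> ediam (\<Inter>G)" if "G \<subseteq> F" "card G = m" for G
    using index[OF that(1)] A(3) that(2) by metis
  moreover have "\<exists>Q\<in>P. ediam (\<Inter>Q) < 1" if P: "partition_on F P" "card P = k" for P
  proof -
    \<comment> \<open>Here \<open>card P * m\<close> is exactly \<open>n - 1\<close>: the one extra
      set forces a part with more than \<open>m\<close> members.\<close>
    have "card P * m < card F"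
      using P by (simp add: cardF m_def n_def)
    then obtain Q where Q: "Q \<in> P" "m < card Q"
      using partition_on_pigeonhole[of F P m] P by (auto simp: F_def)
    moreover have "Q \<subseteq> F"
      using P(1) Q(1) by (auto simp: partition_on_def)
    ultimately show ?thesis
      using index[of Q] A(4) by metis
  qed
  moreover have "\<forall>C\<in>F. convex C"
    using A(2) by (auto simp: F_def)
  ultimately show ?thesis
    using cardF unfolding m_def n_def by blast
qed

end
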